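(* Let $(A,\ast)$ be a Zinbiel algebra and $(B,\diamond)$ a perm algebra. Define a binary operation $\cdot$ on $A\otimes B$ by $$(a_1\otimes b_1)\cdot(a_2\otimes b_2)=(a_1\ast a_2)\otimes(b_1\diamond b_2)+(a_2\ast a_1)\otimes(b_2\diamond b_1)$$ for all $a_1,a_2\in A$ and $b_1,b_2\in B$. Then $(A\otimes B,\cdot)$ is a commutative associative algebra.
   Context: All vector spaces are over a field $\mathbf k$ of characteristic zero; algebras are not required to be unital. A Zinbiel algebra $(A,\ast)$ is a vector space with a bilinear operation such that $a_1\ast(a_2\ast a_3)=(a_1\ast a_2)\ast a_3+(a_2\ast a_1)\ast a_3$ for all $a_1,a_2,a_3\in A$. A perm algebra $(B,\diamond)$ is a vector space with a bilinear operation such that $b_1\diamond(b_2\diamond b_3)=(b_1\diamond b_2)\diamond b_3=(b_2\diamond b_1)\diamond b_3$ for all $b_1,b_2,b_3\in B$. *)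

theory Defs
  imports "HOL-Algebra.Module" "HOL-Algebra.AbelCoset"
begin

section \<open>Algebras over a field of characteristic zero\<close>

locale char_zero_field = field R for R (structure) +
  assumes char_zero: "0 < (n::nat) \<Longrightarrow> [n] \<cdot> \<one> \<noteq> \<zero>"

text \<open>
  A not necessarily associative, commutative, or unital algebra: a vector space with a bilinear
  operation. The operation is the \<open>mult\<close> field of the module record; its \<open>one\<close> field is
  irrelevant throughout.
\<close>

locale bilinear_algebra = module R A + field R for R (structure) and A (structure) +
  assumes mult_closed:
      "\<lbrakk>x \<in> carrier A; y \<in> carrier A\<rbrakk> \<Longrightarrow> x \<otimes>\<^bsub>A\<^esub> y \<in> carrier A"
    and mult_add_left:
      "\<lbrakk>x \<in> carrier A; y \<in> carrier A; z \<in> carrier A\<rbrakk> \<Longrightarrow>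
        (x \<oplus>\<^bsub>A\<^esub> y) \<otimes>\<^bsub>A\<^esub> z = x \<otimes>\<^bsub>A\<^esub> z \<oplus>\<^bsub>A\<^esub> y \<otimes>\<^bsub>A\<^esub> z"
    and mult_add_right:
      "\<lbrakk>x \<in> carrier A; y \<in> carrier A; z \<in> carrier A\<rbrakk> \<Longrightarrow>
        x \<otimes>\<^bsub>A\<^esub> (y \<oplus>\<^bsub>A\<^esub> z) = x \<otimes>\<^bsub>A\<^esub> y \<oplus>\<^bsub>A\<^esub> x \<otimes>\<^bsub>A\<^esub> z"
    and mult_smult_left:
      "\<lbrakk>c \<in> carrier R; x \<in> carrier A; y \<in> carrier A\<rbrakk> \<Longrightarrow>
        (c \<odot>\<^bsub>A\<^esub> x) \<otimes>\<^bsub>A\<^esub> y = c \<odot>\<^bsub>A\<^esub> (x \<otimes>\<^bsub>A\<^esub> y)"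
    and mult_smult_right:
      "\<lbrakk>c \<in> carrier R; x \<in> carrier A; y \<in> carrier A\<rbrakk> \<Longrightarrow>
        x \<otimes>\<^bsub>A\<^esub> (c \<odot>\<^bsub>A\<^esub> y) = c \<odot>\<^bsub>A\<^esub> (x \<otimes>\<^bsub>A\<^esub> y)"

locale zinbiel_algebra = bilinear_algebra +
  assumes zinbiel:
    "\<lbrakk>a1 \<in> carrier A; a2 \<in> carrier A; a3 \<in> carrier A\<rbrakk> \<Longrightarrow>
      a1 \<otimes>\<^bsub>A\<^esub> (a2 \<otimes>\<^bsub>A\<^esub> a3) =
        (a1 \<otimes>\<^bsub>A\<^esub> a2) \<otimes>\<^bsub>A\<^esub> a3 \<oplus>\<^bsub>A\<^esub> (a2 \<otimes>\<^bsub>A\<^esub> a1) \<otimes>\<^bsub>A\<^esub> a3"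

locale perm_algebra = bilinear_algebra +
  assumes perm_assoc:
    "\<lbrakk>b1 \<in> carrier A; b2 \<in> carrier A; b3 \<in> carrier A\<rbrakk> \<Longrightarrow>
      b1 \<otimes>\<^bsub>A\<^esub> (b2 \<otimes>\<^bsub>A\<^esub> b3) = (b1 \<otimes>\<^bsub>A\<^esub> b2) \<otimes>\<^bsub>A\<^esub> b3"
    and perm_left_commute:
    "\<lbrakk>b1 \<in> carrier A; b2 \<in> carrier A; b3 \<in> carrier A\<rbrakk> \<Longrightarrow>
      (b1 \<otimes>\<^bsub>A\<^esub> b2) \<otimes>\<^bsub>A\<^esub> b3 = (b2 \<otimes>\<^bsub>A\<^esub> b1) \<otimes>\<^bsub>A\<^esub> b3"

locale comm_assoc_algebra = bilinear_algebra +
  assumes mult_assoc: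
    "\<lbrakk>x \<in> carrier A; y \<in> carrier A; z \<in> carrier A\<rbrakk> \<Longrightarrow>
      (x \<otimes>\<^bsub>A\<^esub> y) \<otimes>\<^bsub>A\<^esub> z = x \<otimes>\<^bsub>A\<^esub> (y \<otimes>\<^bsub>A\<^esub> z)"
    and mult_comm:
    "\<lbrakk>x \<in> carrier A; y \<in> carrier A\<rbrakk> \<Longrightarrow> x \<otimes>\<^bsub>A\<^esub> y = y \<otimes>\<^bsub>A\<^esub> x"


section \<open>Tensor products\<close>

text \<open>
  The tensor product of two modules is the quotient of the free module on the product of their
  carriers by the submodule generated by the bilinearity relations. The constructions below are
  modules only, so the ring fields \<open>mult\<close> and \<open>one\<close> of the records are left undefined.
\<close>

definition free_module :: "('k, 'm) ring_scheme \<Rightarrow> 'x set \<Rightarrow> ('k, 'x \<Rightarrow> 'k) module" where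
  "free_module R X =
    \<lparr>carrier = {f. (\<forall>x. f x \<in> carrier R) \<and> finite {x. f x \<noteq> \<zero>\<^bsub>R\<^esub>} \<and> {x. f x \<noteq> \<zero>\<^bsub>R\<^esub>} \<subseteq> X},
     mult = undefined,
     one = undefined,
     zero = (\<lambda>x. \<zero>\<^bsub>R\<^esub>),
     add = (\<lambda>f g x. f x \<oplus>\<^bsub>R\<^esub> g x),
     smult = (\<lambda>c f x. c \<otimes>\<^bsub>R\<^esub> f x)\<rparr>"

definition free_gen :: "('k, 'm) ring_scheme \<Rightarrow> 'x \<Rightarrow> 'x \<Rightarrow> 'k" where
  "free_gen R p = (\<lambda>x. if x = p then \<one>\<^bsub>R\<^esub> else \<zero>\<^bsub>R\<^esub>)"

definition submodule_generated ::
    "('k, 'm) ring_scheme \<Rightarrow> ('k, 'v, 'n) module_scheme \<Rightarrow> 'v set \<Rightarrow> 'v set" where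
  "submodule_generated R M S = \<Inter>{N. submodule N R M \<and> S \<subseteq> N}"

text \<open>
  Elements of the quotient are cosets. The scalar multiple of a coset is written without a choice
  of representative: all members of \<open>X\<close> contribute the same coset to the union.
\<close>

definition quotient_module ::
    "('k, 'v, 'n) module_scheme \<Rightarrow> 'v set \<Rightarrow> ('k, 'v set) module" where
  "quotient_module M N =
    \<lparr>carrier = a_rcosets\<^bsub>M\<^esub> N,
     mult = undefined,
     one = undefined,
     zero = N,
     add = (\<lambda>X Y. X <+>\<^bsub>M\<^esub> Y),
     smult = (\<lambda>c X. \<Union>x\<in>X. N +>\<^bsub>M\<^esub> (c \<odot>\<^bsub>M\<^esub> x))\<rparr>"

definition bilinear_relations ::
    "('k, 'm) ring_scheme \<Rightarrow> ('k, 'a, 'n) module_scheme \<Rightarrow> ('k, 'b, 'p) module_scheme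
      \<Rightarrow> ('a \<times> 'b \<Rightarrow> 'k) set" where
  "bilinear_relations R A B =
    (let F = free_module R (carrier A \<times> carrier B); g = (\<lambda>a b. free_gen R (a, b)) in
      {g (a \<oplus>\<^bsub>A\<^esub> a') b \<ominus>\<^bsub>F\<^esub> (g a b \<oplus>\<^bsub>F\<^esub> g a' b) | a a' b.
        a \<in> carrier A \<and> a' \<in> carrier A \<and> b \<in> carrier B} \<union>
      {g a (b \<oplus>\<^bsub>B\<^esub> b') \<ominus>\<^bsub>F\<^esub> (g a b \<oplus>\<^bsub>F\<^esub> g a b') | a b b'.
        a \<in> carrier A \<and> b \<in> carrier B \<and> b' \<in> carrier B} \<union>
      {g (c \<odot>\<^bsub>A\<^esub> a) b \<ominus>\<^bsub>F\<^esub> (c \<odot>\<^bsub>F\<^esub> g a b) | c a b.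
        c \<in> carrier R \<and> a \<in> carrier A \<and> b \<in> carrier B} \<union>
      {g a (c \<odot>\<^bsub>B\<^esub> b) \<ominus>\<^bsub>F\<^esub> (c \<odot>\<^bsub>F\<^esub> g a b) | c a b.
        c \<in> carrier R \<and> a \<in> carrier A \<and> b \<in> carrier B})"

definition tensor_kernel ::
    "('k, 'm) ring_scheme \<Rightarrow> ('k, 'a, 'n) module_scheme \<Rightarrow> ('k, 'b, 'p) module_scheme
      \<Rightarrow> ('a \<times> 'b \<Rightarrow> 'k) set" where
  "tensor_kernel R A B =
    submodule_generated R (free_module R (carrier A \<times> carrier B)) (bilinear_relations R A B)"

definition tensor_product ::
    "('k, 'm) ring_scheme \<Rightarrow> ('k, 'a, 'n) module_scheme \<Rightarrow> ('k, 'b, 'p) module_scheme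
      \<Rightarrow> ('k, ('a \<times> 'b \<Rightarrow> 'k) set) module" where
  "tensor_product R A B =
    quotient_module (free_module R (carrier A \<times> carrier B)) (tensor_kernel R A B)"

definition pure_tensor ::
    "('k, 'm) ring_scheme \<Rightarrow> ('k, 'a, 'n) module_scheme \<Rightarrow> ('k, 'b, 'p) module_scheme
      \<Rightarrow> 'a \<Rightarrow> 'b \<Rightarrow> ('a \<times> 'b \<Rightarrow> 'k) set" where
  "pure_tensor R A B a b =
    tensor_kernel R A B +>\<^bsub>free_module R (carrier A \<times> carrier B)\<^esub> free_gen R (a, b)"


section \<open>The product on the tensor product of two algebras\<close>

text \<open>
  A formula for products of pure tensors determines an operation only together with bilinearity,
  which is therefore part of the specification.
\<close>

definition is_tensor_mult ::
    "('k, 'm) ring_scheme \<Rightarrow> ('k, 'a, 'n) module_scheme \<Rightarrow> ('k, 'b, 'p) module_scheme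
      \<Rightarrow> (('a \<times> 'b \<Rightarrow> 'k) set \<Rightarrow> ('a \<times> 'b \<Rightarrow> 'k) set \<Rightarrow> ('a \<times> 'b \<Rightarrow> 'k) set) \<Rightarrow> bool" where
  "is_tensor_mult R A B m \<longleftrightarrow>
    bilinear_algebra R (tensor_product R A B\<lparr>mult := m\<rparr>) \<and>
    (\<forall>a1\<in>carrier A. \<forall>a2\<in>carrier A. \<forall>b1\<in>carrier B. \<forall>b2\<in>carrier B.
      m (pure_tensor R A B a1 b1) (pure_tensor R A B a2 b2) =
        pure_tensor R A B (a1 \<otimes>\<^bsub>A\<^esub> a2) (b1 \<otimes>\<^bsub>B\<^esub> b2)
        \<oplus>\<^bsub>tensor_product R A B\<^esub> pure_tensor R A B (a2 \<otimes>\<^bsub>A\<^esub> a1) (b2 \<otimes>\<^bsub>B\<^esub> b1))"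

end

(*
  The universal property of the tensor product turns the formula on pure tensors, which is linear in
  each of its four arguments, into a unique bilinear operation, and it suffices to check the
  identities on pure tensors. Commutativity is visible from the formula. For associativity, the
  Zinbiel and perm identities rewrite the product of three pure tensors, in either bracketing, as
  the sum over k = 1, 2, 3 of ((a_i * a_j) * a_k + (a_j * a_i) * a_k) tensor ((b_i * b_j) * b_k),
  where {i, j, k} = {1, 2, 3}; by the perm identity the second factor is symmetric in i and j.
*)

theory Submission
  imports Defs
begin

section \<open>Linear and bilinear maps\<close>

text \<open>Only the behaviour on carriers is constrained, and neither structure has to be a module.
  Composition therefore works for bare records, and a map may take any value off the
  carrier.\<close>

definition linear_map ::
    "('k, 'm) ring_scheme \<Rightarrow> ('k, 'a, 'n) module_scheme \<Rightarrow> ('k, 'b, 'p) module_scheme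
      \<Rightarrow> ('a \<Rightarrow> 'b) \<Rightarrow> bool" where
  "linear_map R M N f \<longleftrightarrow>
    (\<forall>x\<in>carrier M. f x \<in> carrier N) \<and>
    (\<forall>x\<in>carrier M. \<forall>y\<in>carrier M. f (x \<oplus>\<^bsub>M\<^esub> y) = f x \<oplus>\<^bsub>N\<^esub> f y) \<and>
    (\<forall>c\<in>carrier R. \<forall>x\<in>carrier M. f (c \<odot>\<^bsub>M\<^esub> x) = c \<odot>\<^bsub>N\<^esub> f x)"

definition bilinear_map ::
    "('k, 'm) ring_scheme \<Rightarrow> ('k, 'a, 'n) module_scheme \<Rightarrow> ('k, 'b, 'p) module_scheme
      \<Rightarrow> ('k, 'c, 'q) module_scheme \<Rightarrow> ('a \<Rightarrow> 'b \<Rightarrow> 'c) \<Rightarrow> bool" where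
  "bilinear_map R M N P \<beta> \<longleftrightarrow>
    (\<forall>x\<in>carrier M. linear_map R N P (\<beta> x)) \<and>
    (\<forall>y\<in>carrier N. linear_map R M P (\<lambda>x. \<beta> x y))"

lemma linear_mapI:
  assumes "\<And>x. x \<in> carrier M \<Longrightarrow> f x \<in> carrier N"
    and "\<And>x y. \<lbrakk>x \<in> carrier M; y \<in> carrier M\<rbrakk> \<Longrightarrow> f (x \<oplus>\<^bsub>M\<^esub> y) = f x \<oplus>\<^bsub>N\<^esub> f y"
    and "\<And>c x. \<lbrakk>c \<in> carrier R; x \<in> carrier M\<rbrakk> \<Longrightarrow> f (c \<odot>\<^bsub>M\<^esub> x) = c \<odot>\<^bsub>N\<^esub> f x"
  shows "linear_map R M N f"
  using assms by (simp add: linear_map_def)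

lemma linear_mapD:
  assumes "linear_map R M N f"
  shows "x \<in> carrier M \<Longrightarrow> f x \<in> carrier N"
    and "\<lbrakk>x \<in> carrier M; y \<in> carrier M\<rbrakk> \<Longrightarrow> f (x \<oplus>\<^bsub>M\<^esub> y) = f x \<oplus>\<^bsub>N\<^esub> f y"
    and "\<lbrakk>c \<in> carrier R; x \<in> carrier M\<rbrakk> \<Longrightarrow> f (c \<odot>\<^bsub>M\<^esub> x) = c \<odot>\<^bsub>N\<^esub> f x"
  using assms by (simp_all add: linear_map_def)

lemma bilinear_mapI:
  assumes "\<And>x. x \<in> carrier M \<Longrightarrow> linear_map R N P (\<beta> x)"
    and "\<And>y. y \<in> carrier N \<Longrightarrow> linear_map R M P (\<lambda>x. \<beta> x y)"
  shows "bilinear_map R M N P \<beta>"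
  using assms by (simp add: bilinear_map_def)

lemma bilinear_mapD:
  assumes "bilinear_map R M N P \<beta>"
  shows "x \<in> carrier M \<Longrightarrow> linear_map R N P (\<beta> x)"
    and "y \<in> carrier N \<Longrightarrow> linear_map R M P (\<lambda>x. \<beta> x y)"
  using assms by (simp_all add: bilinear_map_def)

lemma linear_map_comp:
  "\<lbrakk>linear_map R M N f; linear_map R N P g\<rbrakk> \<Longrightarrow> linear_map R M P (\<lambda>x. g (f x))"
  by (simp add: linear_map_def)

lemma (in module) linear_map_add:
  assumes "linear_map R L M f" and "linear_map R L M g"
  shows "linear_map R L M (\<lambda>x. f x \<oplus>\<^bsub>M\<^esub> g x)"
  by (rule linear_mapI)
    (simp_all add: linear_mapD[OF assms(1)] linear_mapD[OF assms(2)] smult_r_distr M.a_ac)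

text \<open>Homogeneity holds because scalars commute. With \<open>linear_map_add\<close>, this
  turns the right-hand side of a linearity law in some parameter into a linear map, so that both
  sides of the law can be compared by \<open>linear_map_eqI\<close>.\<close>

lemma (in module) linear_map_smult:
  assumes "linear_map R L M f" and "c \<in> carrier R"
  shows "linear_map R L M (\<lambda>x. c \<odot>\<^bsub>M\<^esub> f x)"
  using assms(2)
  by (intro linear_mapI)
    (simp_all add: linear_mapD[OF assms(1)] smult_r_distr smult_assoc1[symmetric] R.m_comm)

lemma bilinear_map_comp:
  assumes "bilinear_map R M N P \<beta>" and "linear_map R M' M f" and "linear_map R N' N g"
  shows "bilinear_map R M' N' P (\<lambda>x y. \<beta> (f x) (g y))"
proof (rule bilinear_mapI)
  show "linear_map R N' P (\<lambda>y. \<beta> (f x) (g y))" if "x \<in> carrier M'" for x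
    using linear_map_comp[OF assms(3) bilinear_mapD(1)[OF assms(1)]] linear_mapD(1)[OF assms(2) that]
    by blast
  show "linear_map R M' P (\<lambda>x. \<beta> (f x) (g y))" if "y \<in> carrier N'" for y
    using linear_map_comp[OF assms(2) bilinear_mapD(2)[OF assms(1)]] linear_mapD(1)[OF assms(3) that]
    by blast
qed

lemma (in module) bilinear_map_add:
  assumes "bilinear_map R L L' M \<beta>" and "bilinear_map R L L' M \<gamma>"
  shows "bilinear_map R L L' M (\<lambda>x y. \<beta> x y \<oplus>\<^bsub>M\<^esub> \<gamma> x y)"
  using assms by (intro bilinear_mapI linear_map_add) (blast dest: bilinear_mapD)+


section \<open>Quotient modules\<close>

lemma (in module) submodule_abelian_subgroup:
  "submodule N R M \<Longrightarrow> abelian_subgroup N M"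
  by (intro abelian_subgroupI3 additive_subgroupI submodule.axioms(1)) (auto simp: M.abelian_group_axioms)

text \<open>The hypothesis on \<open>S\<close> puts \<open>carrier M\<close> itself among the
  submodules intersected. For other \<open>S\<close> the family is empty and its intersection is the
  whole type.\<close>

lemma (in module) submodule_generated_is_submodule:
  assumes "S \<subseteq> carrier M"
  shows "submodule (submodule_generated R M S) R M"
proof (rule submoduleI)
  note mem = submodule_generated_def Inter_iff mem_Collect_eq
  show "submodule_generated R M S \<subseteq> carrier M"
    using assms carrier_is_submodule by (auto simp: submodule_generated_def)
  show "\<zero>\<^bsub>M\<^esub> \<in> submodule_generated R M S"
    unfolding mem
    using additive_subgroup.zero_closed[OF abelian_subgroup.axioms(1)[OF submodule_abelian_subgroup]]
    by blast
  show "\<ominus>\<^bsub>M\<^esub> x \<in> submodule_generated R M S" if "x \<in> submodule_generated R M S" for x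
    using that submoduleE(3) unfolding mem by blast
  show "x \<oplus>\<^bsub>M\<^esub> y \<in> submodule_generated R M S"
    if "x \<in> submodule_generated R M S" "y \<in> submodule_generated R M S" for x y
    using that submoduleE(5) unfolding mem by blast
  show "c \<odot>\<^bsub>M\<^esub> x \<in> submodule_generated R M S"
    if "c \<in> carrier R" "x \<in> submodule_generated R M S" for c x
    using that submoduleE(4) unfolding mem by blast
qed

lemma submodule_generated_minimal:
  "\<lbrakk>submodule N R M; S \<subseteq> N\<rbrakk> \<Longrightarrow> submodule_generated R M S \<subseteq> N"
  by (auto simp: submodule_generated_def)

locale quotient = module +
  fixes N
  assumes submodule: "submodule N R M"
begin

interpretation N: abelian_subgroup N M
  by (rule submodule_abelian_subgroup[OF submodule])

lemma coset_eq_iff: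
  assumes "x \<in> carrier M" and "y \<in> carrier M"
  shows "N +>\<^bsub>M\<^esub> x = N +>\<^bsub>M\<^esub> y \<longleftrightarrow> x \<ominus>\<^bsub>M\<^esub> y \<in> N"
  using N.a_rcos_module[OF assms(2,1)] N.a_rcos_self[OF assms(1)]
    N.a_repr_independence'[OF _ assms(2), of x]
  unfolding a_minus_def by metis

lemma quotient_carrier: "carrier (quotient_module M N) = (\<lambda>x. N +>\<^bsub>M\<^esub> x) ` carrier M"
  by (auto simp: quotient_module_def A_RCOSETS_def')

lemma quotient_zero: "\<zero>\<^bsub>quotient_module M N\<^esub> = N +>\<^bsub>M\<^esub> \<zero>\<^bsub>M\<^esub>"
  by (simp add: quotient_module_def N.a_subset)

lemma quotient_add:
  "\<lbrakk>x \<in> carrier M; y \<in> carrier M\<rbrakk> \<Longrightarrow>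
    (N +>\<^bsub>M\<^esub> x) \<oplus>\<^bsub>quotient_module M N\<^esub> (N +>\<^bsub>M\<^esub> y) = N +>\<^bsub>M\<^esub> (x \<oplus>\<^bsub>M\<^esub> y)"
  by (simp add: quotient_module_def N.a_rcos_sum)

text \<open>If \<open>y\<close> and \<open>x\<close> lie in one coset, then \<open>c\<close> times
  their difference is again in \<open>N\<close>, so all members contribute the same coset to the
  union that defines the scalar action.\<close>

lemma quotient_smult:
  assumes c: "c \<in> carrier R" and x: "x \<in> carrier M"
  shows "c \<odot>\<^bsub>quotient_module M N\<^esub> (N +>\<^bsub>M\<^esub> x) = N +>\<^bsub>M\<^esub> (c \<odot>\<^bsub>M\<^esub> x)"
proof -
  have "N +>\<^bsub>M\<^esub> (c \<odot>\<^bsub>M\<^esub> y) = N +>\<^bsub>M\<^esub> (c \<odot>\<^bsub>M\<^esub> x)" if y: "y \<in> N +>\<^bsub>M\<^esub> x" for y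
  proof -
    have yc: "y \<in> carrier M"
      using y x N.a_elemrcos_carrier by blast
    have "y \<ominus>\<^bsub>M\<^esub> x \<in> N"
      using N.a_rcos_module_imp[OF x y] by (simp add: a_minus_def)
    then have "c \<odot>\<^bsub>M\<^esub> (y \<ominus>\<^bsub>M\<^esub> x) \<in> N"
      using c submoduleE(4)[OF submodule] by blast
    also have "c \<odot>\<^bsub>M\<^esub> (y \<ominus>\<^bsub>M\<^esub> x) = c \<odot>\<^bsub>M\<^esub> y \<ominus>\<^bsub>M\<^esub> c \<odot>\<^bsub>M\<^esub> x"
      using c x yc by (simp add: a_minus_def smult_r_distr smult_r_minus)
    finally show ?thesis
      using c x yc by (simp add: coset_eq_iff)
  qed
  then have "(\<Union>y\<in>N +>\<^bsub>M\<^esub> x. N +>\<^bsub>M\<^esub> (c \<odot>\<^bsub>M\<^esub> y)) = (\<Union>y\<in>N +>\<^bsub>M\<^esub> x. N +>\<^bsub>M\<^esub> (c \<odot>\<^bsub>M\<^esub> x))"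
    by (intro SUP_cong refl)
  \<comment> \<open>The union of a constant family is its value only if the index set is nonempty;
    here it contains \<open>x\<close>.\<close>
  also have "\<dots> = N +>\<^bsub>M\<^esub> (c \<odot>\<^bsub>M\<^esub> x)"
    using N.a_rcos_self[OF x] by (auto simp only: UN_constant split: if_splits)
  finally show ?thesis
    by (simp add: quotient_module_def)
qed

lemma quotient_is_module: "module R (quotient_module M N)"
proof (rule moduleI)
  show "abelian_group (quotient_module M N)"
  proof (rule abelian_groupI)
    fix X assume "X \<in> carrier (quotient_module M N)"
    then obtain x where x: "x \<in> carrier M" "X = N +>\<^bsub>M\<^esub> x"
      by (auto simp: quotient_carrier)
    have "(N +>\<^bsub>M\<^esub> (\<ominus>\<^bsub>M\<^esub> x)) \<oplus>\<^bsub>quotient_module M N\<^esub> X = \<zero>\<^bsub>quotient_module M N\<^esub>"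
      using x by (simp add: quotient_add quotient_zero M.l_neg)
    then show "\<exists>Y\<in>carrier (quotient_module M N). Y \<oplus>\<^bsub>quotient_module M N\<^esub> X = \<zero>\<^bsub>quotient_module M N\<^esub>"
      using x by (auto simp: quotient_carrier)
    fix Y assume "Y \<in> carrier (quotient_module M N)"
    then show "X \<oplus>\<^bsub>quotient_module M N\<^esub> Y = Y \<oplus>\<^bsub>quotient_module M N\<^esub> X"
      using x by (auto simp: quotient_carrier quotient_add M.a_comm)
  qed (auto simp: quotient_carrier quotient_add quotient_zero M.a_assoc)
qed (auto simp: quotient_carrier quotient_add quotient_smult R.is_cring
      smult_l_distr smult_r_distr smult_assoc1)

lemma quotient_lift:
  assumes T: "module R T" and L: "linear_map R M T L" and zero: "\<And>n. n \<in> N \<Longrightarrow> L n = \<zero>\<^bsub>T\<^esub>"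
  shows "\<exists>\<phi>. linear_map R (quotient_module M N) T \<phi> \<and> (\<forall>x\<in>carrier M. \<phi> (N +>\<^bsub>M\<^esub> x) = L x)"
proof -
  interpret T: module R T by (rule T)
  \<comment> \<open>An arbitrary representative of the coset is chosen. The choice is harmless: two
    representatives differ by an element of \<open>N\<close>, where \<open>L\<close>
    vanishes.\<close>
  define \<phi> where "\<phi> X = L (SOME x. x \<in> carrier M \<and> X = N +>\<^bsub>M\<^esub> x)" for X
  have \<phi>: "\<phi> (N +>\<^bsub>M\<^esub> x) = L x" if x: "x \<in> carrier M" for x
  proof -
    define y where "y = (SOME y. y \<in> carrier M \<and> N +>\<^bsub>M\<^esub> x = N +>\<^bsub>M\<^esub> y)"
    have y: "y \<in> carrier M" "N +>\<^bsub>M\<^esub> x = N +>\<^bsub>M\<^esub> y"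
      using someI[of "\<lambda>y. y \<in> carrier M \<and> N +>\<^bsub>M\<^esub> x = N +>\<^bsub>M\<^esub> y" x] x by (auto simp: y_def)
    then have n: "x \<ominus>\<^bsub>M\<^esub> y \<in> N"
      using x coset_eq_iff by blast
    \<comment> \<open>\<open>linear_map\<close> speaks of sums and not of differences, so
      \<open>x\<close> is split as a sum.\<close>
    have "x = (x \<ominus>\<^bsub>M\<^esub> y) \<oplus>\<^bsub>M\<^esub> y"
      using x y by (simp add: a_minus_def M.a_assoc M.l_neg)
    then have "L x = L (x \<ominus>\<^bsub>M\<^esub> y) \<oplus>\<^bsub>T\<^esub> L y"
      using linear_mapD(2)[OF L, of "x \<ominus>\<^bsub>M\<^esub> y" y] x y by simp
    then show ?thesis
      using zero[OF n] linear_mapD(1)[OF L y(1)] by (simp add: \<phi>_def y_def)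
  qed
  have "linear_map R (quotient_module M N) T \<phi>"
    by (rule linear_mapI) (auto simp: quotient_carrier quotient_add quotient_smult \<phi> linear_mapD[OF L])
  with \<phi> show ?thesis by blast
qed

end


section \<open>Free modules\<close>

lemma free_module_simps:
  "f \<in> carrier (free_module R X) \<longleftrightarrow>
    (\<forall>x. f x \<in> carrier R) \<and> finite {x. f x \<noteq> \<zero>\<^bsub>R\<^esub>} \<and> {x. f x \<noteq> \<zero>\<^bsub>R\<^esub>} \<subseteq> X"
  "\<zero>\<^bsub>free_module R X\<^esub> = (\<lambda>x. \<zero>\<^bsub>R\<^esub>)"
  "f \<oplus>\<^bsub>free_module R X\<^esub> g = (\<lambda>x. f x \<oplus>\<^bsub>R\<^esub> g x)"
  "c \<odot>\<^bsub>free_module R X\<^esub> f = (\<lambda>x. c \<otimes>\<^bsub>R\<^esub> f x)"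
  by (simp_all add: free_module_def)

context cring
begin

lemma free_add_closed:
  assumes "f \<in> carrier (free_module R X)" and "g \<in> carrier (free_module R X)"
  shows "f \<oplus>\<^bsub>free_module R X\<^esub> g \<in> carrier (free_module R X)"
proof -
  have "{x. f x \<oplus> g x \<noteq> \<zero>} \<subseteq> {x. f x \<noteq> \<zero>} \<union> {x. g x \<noteq> \<zero>}"
    by auto
  moreover from this have "finite {x. f x \<oplus> g x \<noteq> \<zero>}"
    by (rule finite_subset) (use assms in \<open>simp add: free_module_simps\<close>)
  ultimately show ?thesis
    using assms by (simp add: free_module_simps) blast
qed

lemma free_smult_closed:
  assumes "c \<in> carrier R" and "f \<in> carrier (free_module R X)"
  shows "c \<odot>\<^bsub>free_module R X\<^esub> f \<in> carrier (free_module R X)"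
proof -
  have "{x. c \<otimes> f x \<noteq> \<zero>} \<subseteq> {x. f x \<noteq> \<zero>}"
    using assms by auto
  moreover from this have "finite {x. c \<otimes> f x \<noteq> \<zero>}"
    by (rule finite_subset) (use assms in \<open>simp add: free_module_simps\<close>)
  ultimately show ?thesis
    using assms by (simp add: free_module_simps) blast
qed

lemma free_module_is_module: "module R (free_module R X)"
proof (rule moduleI)
  show "abelian_group (free_module R X)"
  proof (rule abelian_groupI)
    fix f assume f: "f \<in> carrier (free_module R X)"
    \<comment> \<open>The additive inverse is taken as a scalar multiple, so that finiteness of its
      support comes from \<open>free_smult_closed\<close>.\<close>
    have "(\<ominus> \<one>) \<odot>\<^bsub>free_module R X\<^esub> f \<in> carrier (free_module R X)"
      using f by (intro free_smult_closed) auto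
    moreover have "((\<ominus> \<one>) \<odot>\<^bsub>free_module R X\<^esub> f) \<oplus>\<^bsub>free_module R X\<^esub> f = \<zero>\<^bsub>free_module R X\<^esub>"
      using f by (auto simp: free_module_simps l_minus l_neg)
    ultimately show "\<exists>g\<in>carrier (free_module R X). g \<oplus>\<^bsub>free_module R X\<^esub> f = \<zero>\<^bsub>free_module R X\<^esub>"
      by blast
  qed (use free_add_closed in \<open>auto simp: free_module_simps a_ac\<close>)
qed (auto intro: free_add_closed free_smult_closed is_cring,
    auto simp: free_module_simps l_distr r_distr m_assoc)

lemma free_gen_closed: "p \<in> X \<Longrightarrow> free_gen R p \<in> carrier (free_module R X)"
  by (auto simp: free_module_simps free_gen_def)

text \<open>A finitely supported function is a finite combination of generators, built up by one
  point of the support at a time.\<close>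

lemma free_module_induct [consumes 1, case_names zero add]:
  assumes "f \<in> carrier (free_module R X)"
    and zero: "P \<zero>\<^bsub>free_module R X\<^esub>"
    and add: "\<And>f c p. \<lbrakk>f \<in> carrier (free_module R X); P f; c \<in> carrier R; p \<in> X\<rbrakk> \<Longrightarrow>
      P (f \<oplus>\<^bsub>free_module R X\<^esub> c \<odot>\<^bsub>free_module R X\<^esub> free_gen R p)"
  shows "P f"
proof -
  \<comment> \<open>The induction runs over a finite set \<open>S\<close> that merely contains the
    support. If \<open>f\<close> vanishes at the inserted point, the smaller set already serves;
    otherwise the value there is erased and added back as a multiple of a generator.\<close>
  have "f \<in> carrier (free_module R X) \<Longrightarrow> {x. f x \<noteq> \<zero>} \<subseteq> S \<Longrightarrow> P f" if "finite S" for S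
    using that
  proof (induction S arbitrary: f rule: finite_induct)
    case empty
    then have "f = \<zero>\<^bsub>free_module R X\<^esub>" by (auto simp: free_module_simps)
    then show ?case using zero by simp
  next
    case (insert p S)
    show ?case
    proof (cases "f p = \<zero>")
      case True
      then show ?thesis using insert by blast
    next
      case False
      define g where "g = f(p := \<zero>)"
      have "{x. g x \<noteq> \<zero>} \<subseteq> {x. f x \<noteq> \<zero>}" by (auto simp: g_def)
      moreover from this have "finite {x. g x \<noteq> \<zero>}"
        by (rule finite_subset) (use insert.prems in \<open>simp add: free_module_simps\<close>)
      ultimately have g: "g \<in> carrier (free_module R X)"
        using insert.prems by (auto simp: free_module_simps g_def)
      have "{x. g x \<noteq> \<zero>} \<subseteq> S" using insert.prems by (auto simp: g_def)
      then have "P g" using insert.IH g by blast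
      moreover have "f p \<in> carrier R" "p \<in> X"
        using False insert.prems by (auto simp: free_module_simps)
      moreover have "f = g \<oplus>\<^bsub>free_module R X\<^esub> f p \<odot>\<^bsub>free_module R X\<^esub> free_gen R p"
        using insert.prems by (auto simp: free_module_simps g_def free_gen_def)
      ultimately show ?thesis using add g by metis
    qed
  qed
  then show ?thesis using assms(1) by (auto simp: free_module_simps)
qed

end

text \<open>The existence half of the universal property of the free module: the extension sums
  \<open>f p\<close> times the image of \<open>p\<close> over the support of
  \<open>f\<close>.\<close>

lemma (in module) free_lift:
  assumes \<beta>: "\<And>p. p \<in> X \<Longrightarrow> \<beta> p \<in> carrier M"
  shows "\<exists>L. linear_map R (free_module R X) M L \<and> (\<forall>p\<in>X. L (free_gen R p) = \<beta> p)"
proof -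
  define L where "L f = (\<Oplus>\<^bsub>M\<^esub>p\<in>{p. f p \<noteq> \<zero>}. f p \<odot>\<^bsub>M\<^esub> \<beta> p)" for f
  have term_closed: "(\<lambda>p. f p \<odot>\<^bsub>M\<^esub> \<beta> p) \<in> S \<rightarrow> carrier M"
    if "f \<in> carrier (free_module R X)" "S \<subseteq> X" for f S
    using that \<beta> by (auto simp: free_module_simps)
  \<comment> \<open>Supports change under addition and scaling. Since terms off the support vanish,
    any finite \<open>S\<close> between the support and \<open>X\<close> may index the sum, and the
    functions in one law can share it.\<close>
  have L: "L f = (\<Oplus>\<^bsub>M\<^esub>p\<in>S. f p \<odot>\<^bsub>M\<^esub> \<beta> p)"
    if f: "f \<in> carrier (free_module R X)" and S: "finite S" "S \<subseteq> X" "{p. f p \<noteq> \<zero>} \<subseteq> S" for f S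
    unfolding L_def
  proof (rule M.add.finprod_mono_neutral_cong_left)
    show "(\<lambda>p. f p \<odot>\<^bsub>M\<^esub> \<beta> p) \<in> S \<rightarrow> carrier M" by (rule term_closed[OF f S(2)])
    show "f p \<odot>\<^bsub>M\<^esub> \<beta> p = \<zero>\<^bsub>M\<^esub>" if "p \<in> S - {p. f p \<noteq> \<zero>}" for p
      using that S \<beta> by auto
  qed (use S in auto)
  have "linear_map R (free_module R X) M L"
  proof (rule linear_mapI)
    fix f assume f: "f \<in> carrier (free_module R X)"
    define S where "S = {p. f p \<noteq> \<zero>}"
    have S: "finite S" "S \<subseteq> X" "{p. f p \<noteq> \<zero>} \<subseteq> S"
      using f by (auto simp: free_module_simps S_def)
    show "L f \<in> carrier M"
      using term_closed[OF f S(2)] by (simp add: L[OF f S])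
    fix c assume c: "c \<in> carrier R"
    have "L (c \<odot>\<^bsub>free_module R X\<^esub> f) = (\<Oplus>\<^bsub>M\<^esub>p\<in>S. (c \<odot>\<^bsub>free_module R X\<^esub> f) p \<odot>\<^bsub>M\<^esub> \<beta> p)"
      using S c by (intro L R.free_smult_closed f) (auto simp: free_module_simps)
    also have "\<dots> = (\<Oplus>\<^bsub>M\<^esub>p\<in>S. c \<odot>\<^bsub>M\<^esub> (f p \<odot>\<^bsub>M\<^esub> \<beta> p))"
      using S c f \<beta> by (intro M.finsum_cong') (auto simp: free_module_simps smult_assoc1 subset_iff)
    also have "\<dots> = c \<odot>\<^bsub>M\<^esub> L f"
      using finsum_smult_ldistr[OF S(1) c term_closed[OF f S(2)]] by (simp add: L[OF f S])
    finally show "L (c \<odot>\<^bsub>free_module R X\<^esub> f) = c \<odot>\<^bsub>M\<^esub> L f" .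
  next
    fix f g assume f: "f \<in> carrier (free_module R X)" and g: "g \<in> carrier (free_module R X)"
    \<comment> \<open>A common index set for \<open>f\<close>, \<open>g\<close> and their sum, whose
      support may be smaller through cancellation.\<close>
    define S where "S = {p. f p \<noteq> \<zero>} \<union> {p. g p \<noteq> \<zero>}"
    have S: "finite S" "S \<subseteq> X" "{p. f p \<noteq> \<zero>} \<subseteq> S" "{p. g p \<noteq> \<zero>} \<subseteq> S"
      using f g by (auto simp: free_module_simps S_def)
    have "L (f \<oplus>\<^bsub>free_module R X\<^esub> g) = (\<Oplus>\<^bsub>M\<^esub>p\<in>S. (f \<oplus>\<^bsub>free_module R X\<^esub> g) p \<odot>\<^bsub>M\<^esub> \<beta> p)"
      using S by (intro L R.free_add_closed f g) (auto simp: free_module_simps S_def)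
    also have "\<dots> = (\<Oplus>\<^bsub>M\<^esub>p\<in>S. f p \<odot>\<^bsub>M\<^esub> \<beta> p \<oplus>\<^bsub>M\<^esub> g p \<odot>\<^bsub>M\<^esub> \<beta> p)"
      using S f g \<beta> by (intro M.finsum_cong') (auto simp: free_module_simps smult_l_distr subset_iff)
    also have "\<dots> = L f \<oplus>\<^bsub>M\<^esub> L g"
      using M.finsum_addf[OF term_closed[OF f S(2)] term_closed[OF g S(2)]]
      by (simp add: L[OF f S(1-3)] L[OF g S(1,2,4)])
    finally show "L (f \<oplus>\<^bsub>free_module R X\<^esub> g) = L f \<oplus>\<^bsub>M\<^esub> L g" .
  qed
  moreover have "L (free_gen R p) = \<beta> p" if p: "p \<in> X" for p
  proof -
    have "L (free_gen R p) = (\<Oplus>\<^bsub>M\<^esub>q\<in>{p}. free_gen R p q \<odot>\<^bsub>M\<^esub> \<beta> q)"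
      using p by (intro L R.free_gen_closed) (auto simp: free_gen_def)
    then show ?thesis using \<beta>[OF p] by (simp add: free_gen_def)
  qed
  ultimately show ?thesis by blast
qed


section \<open>Tensor products\<close>

locale tensor = A: module R A + B: module R B for R (structure) and A and B
begin

abbreviation F where "F \<equiv> free_module R (carrier A \<times> carrier B)"
abbreviation T where "T \<equiv> tensor_product R A B"
abbreviation pt where "pt \<equiv> pure_tensor R A B"

sublocale F: module R F
  by (rule A.R.free_module_is_module)

lemma gen_closed:
  "\<lbrakk>a \<in> carrier A; b \<in> carrier B\<rbrakk> \<Longrightarrow> free_gen R (a, b) \<in> carrier F"
  by (rule A.R.free_gen_closed) simp

lemma bilinear_relations_closed: "bilinear_relations R A B \<subseteq> carrier F"
  unfolding bilinear_relations_def Let_def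
  by (auto intro!: F.M.minus_closed F.M.add.m_closed F.smult_closed gen_closed)

sublocale Q: quotient R F "tensor_kernel R A B"
  unfolding tensor_kernel_def
  by (intro quotient.intro quotient_axioms.intro F.module_axioms
      F.submodule_generated_is_submodule bilinear_relations_closed)

sublocale T: module R T
  unfolding tensor_product_def by (rule Q.quotient_is_module)

lemma relations_in_kernel: "bilinear_relations R A B \<subseteq> tensor_kernel R A B"
  by (auto simp: tensor_kernel_def submodule_generated_def)

lemma pt_closed [simp, intro]: "\<lbrakk>a \<in> carrier A; b \<in> carrier B\<rbrakk> \<Longrightarrow> pt a b \<in> carrier T"
  by (auto simp: pure_tensor_def tensor_product_def Q.quotient_carrier intro: gen_closed)

text \<open>Each of the four laws that follow is one family of generators of the kernel, read modulo
  the kernel.\<close>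

lemma pt_eqI:
  assumes "free_gen R (a, b) \<ominus>\<^bsub>F\<^esub> g \<in> bilinear_relations R A B"
    and "a \<in> carrier A" and "b \<in> carrier B" and "g \<in> carrier F"
  shows "pt a b = tensor_kernel R A B +>\<^bsub>F\<^esub> g"
  using assms relations_in_kernel by (auto simp: pure_tensor_def Q.coset_eq_iff gen_closed)

lemma pt_add_left:
  assumes "a \<in> carrier A" and "a' \<in> carrier A" and "b \<in> carrier B"
  shows "pt (a \<oplus>\<^bsub>A\<^esub> a') b = pt a b \<oplus>\<^bsub>T\<^esub> pt a' b"
proof -
  have "pt (a \<oplus>\<^bsub>A\<^esub> a') b
    = tensor_kernel R A B +>\<^bsub>F\<^esub> (free_gen R (a, b) \<oplus>\<^bsub>F\<^esub> free_gen R (a', b))"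
    using assms by (intro pt_eqI F.M.add.m_closed gen_closed) (auto simp: bilinear_relations_def Let_def)
  then show ?thesis
    using assms by (simp add: pure_tensor_def tensor_product_def Q.quotient_add gen_closed)
qed

lemma pt_add_right:
  assumes "a \<in> carrier A" and "b \<in> carrier B" and "b' \<in> carrier B"
  shows "pt a (b \<oplus>\<^bsub>B\<^esub> b') = pt a b \<oplus>\<^bsub>T\<^esub> pt a b'"
proof -
  have "pt a (b \<oplus>\<^bsub>B\<^esub> b')
    = tensor_kernel R A B +>\<^bsub>F\<^esub> (free_gen R (a, b) \<oplus>\<^bsub>F\<^esub> free_gen R (a, b'))"
    using assms by (intro pt_eqI F.M.add.m_closed gen_closed) (auto simp: bilinear_relations_def Let_def)
  then show ?thesis
    using assms by (simp add: pure_tensor_def tensor_product_def Q.quotient_add gen_closed)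
qed

lemma pt_smult_left:
  assumes "c \<in> carrier R" and "a \<in> carrier A" and "b \<in> carrier B"
  shows "pt (c \<odot>\<^bsub>A\<^esub> a) b = c \<odot>\<^bsub>T\<^esub> pt a b"
proof -
  have "pt (c \<odot>\<^bsub>A\<^esub> a) b = tensor_kernel R A B +>\<^bsub>F\<^esub> (c \<odot>\<^bsub>F\<^esub> free_gen R (a, b))"
    using assms by (intro pt_eqI F.smult_closed gen_closed) (auto simp: bilinear_relations_def Let_def)
  then show ?thesis
    using assms by (simp add: pure_tensor_def tensor_product_def Q.quotient_smult gen_closed)
qed

lemma pt_smult_right:
  assumes "c \<in> carrier R" and "a \<in> carrier A" and "b \<in> carrier B"
  shows "pt a (c \<odot>\<^bsub>B\<^esub> b) = c \<odot>\<^bsub>T\<^esub> pt a b"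
proof -
  have "pt a (c \<odot>\<^bsub>B\<^esub> b) = tensor_kernel R A B +>\<^bsub>F\<^esub> (c \<odot>\<^bsub>F\<^esub> free_gen R (a, b))"
    using assms by (intro pt_eqI F.smult_closed gen_closed) (auto simp: bilinear_relations_def Let_def)
  then show ?thesis
    using assms by (simp add: pure_tensor_def tensor_product_def Q.quotient_smult gen_closed)
qed

section \<open>The universal property of the tensor product\<close>

lemma bilinear_pt: "bilinear_map R A B T pt"
  by (intro bilinear_mapI linear_mapI)
    (simp_all add: pt_add_left pt_add_right pt_smult_left pt_smult_right)

text \<open>Pure tensors span, because the generators span the free module and the quotient map is
  linear. Multilinear identities can hence be checked on pure tensors alone.\<close>

lemma tensor_induct [consumes 1, case_names pure add smult]:
  assumes "x \<in> carrier T"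
    and pure: "\<And>a b. \<lbrakk>a \<in> carrier A; b \<in> carrier B\<rbrakk> \<Longrightarrow> P (pt a b)"
    and add: "\<And>x y. \<lbrakk>x \<in> carrier T; y \<in> carrier T; P x; P y\<rbrakk> \<Longrightarrow> P (x \<oplus>\<^bsub>T\<^esub> y)"
    and smult: "\<And>c x. \<lbrakk>c \<in> carrier R; x \<in> carrier T; P x\<rbrakk> \<Longrightarrow> P (c \<odot>\<^bsub>T\<^esub> x)"
  shows "P x"
proof -
  define q where "q f = tensor_kernel R A B +>\<^bsub>F\<^esub> f" for f
  have q_closed: "q f \<in> carrier T" if "f \<in> carrier F" for f
    using that by (simp add: q_def tensor_product_def Q.quotient_carrier)
  obtain f where f: "f \<in> carrier F" and x: "x = q f"
    using assms(1) by (auto simp: q_def tensor_product_def Q.quotient_carrier)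
  from f have "P (q f)"
  proof (induction rule: A.R.free_module_induct)
    case zero
    \<comment> \<open>The rule has no case for zero, so zero is reached as the scalar 0 times some
      pure tensor.\<close>
    have "P (\<zero> \<odot>\<^bsub>T\<^esub> pt \<zero>\<^bsub>A\<^esub> \<zero>\<^bsub>B\<^esub>)"
      by (intro smult pure pt_closed) simp_all
    then show ?case
      by (simp add: q_def Q.quotient_zero[symmetric] tensor_product_def[symmetric])
  next
    case (add f c p)
    obtain a b where p: "p = (a, b)" "a \<in> carrier A" "b \<in> carrier B"
      using \<open>p \<in> carrier A \<times> carrier B\<close> by blast
    have "P (q f \<oplus>\<^bsub>T\<^esub> c \<odot>\<^bsub>T\<^esub> pt a b)"
      using add p by (intro assms(3) smult pure pt_closed T.smult_closed q_closed) auto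
    then show ?case
      using add p
      by (simp add: q_def pure_tensor_def tensor_product_def Q.quotient_add Q.quotient_smult gen_closed)
  qed
  then show ?thesis by (simp add: x)
qed

text \<open>The uniqueness half of the universal property.\<close>

lemma linear_map_eqI:
  assumes "linear_map R T W f" and "linear_map R T W g"
    and "\<And>a b. \<lbrakk>a \<in> carrier A; b \<in> carrier B\<rbrakk> \<Longrightarrow> f (pt a b) = g (pt a b)"
    and "x \<in> carrier T"
  shows "f x = g x"
  using assms(4)
  by (induction rule: tensor_induct)
    (simp_all add: assms(3) linear_mapD[OF assms(1)] linear_mapD[OF assms(2)])

text \<open>The existence half: the linear extension \<open>L\<close> of \<beta> to the free module
  kills the bilinearity relations, hence the submodule that they generate, and so descends to the
  quotient.\<close>

lemma tensor_lift:
  assumes W: "module R W" and \<beta>: "bilinear_map R A B W \<beta>"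
  shows "\<exists>\<phi>. linear_map R T W \<phi> \<and> (\<forall>a\<in>carrier A. \<forall>b\<in>carrier B. \<phi> (pt a b) = \<beta> a b)"
proof -
  interpret W: module R W by (rule W)
  note \<beta>1 = linear_mapD[OF bilinear_mapD(1)[OF \<beta>]] and \<beta>2 = linear_mapD[OF bilinear_mapD(2)[OF \<beta>]]
  obtain L where L: "linear_map R F W L"
    and gen: "\<And>p. p \<in> carrier A \<times> carrier B \<Longrightarrow> L (free_gen R p) = case_prod \<beta> p"
  proof -
    have "case_prod \<beta> p \<in> carrier W" if "p \<in> carrier A \<times> carrier B" for p
      using that by (auto intro: \<beta>1(1))
    then show ?thesis using W.free_lift[of "carrier A \<times> carrier B" "case_prod \<beta>"] that by blast
  qed
  have L_zero: "L \<zero>\<^bsub>F\<^esub> = \<zero>\<^bsub>W\<^esub>"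
    using linear_mapD(3)[OF L, of \<zero> "\<zero>\<^bsub>F\<^esub>"] linear_mapD(1)[OF L, of "\<zero>\<^bsub>F\<^esub>"] by simp
  \<comment> \<open>Every bilinearity relation is a difference, so \<open>L\<close> kills it once
    both terms have the same image; bilinearity of \<beta> provides that.\<close>
  have L_minus: "L (f \<ominus>\<^bsub>F\<^esub> g) = \<zero>\<^bsub>W\<^esub>"
    if "f \<in> carrier F" "g \<in> carrier F" "L f = L g" for f g
  proof -
    have "L (f \<ominus>\<^bsub>F\<^esub> g) \<oplus>\<^bsub>W\<^esub> L g = L f"
      using linear_mapD(2)[OF L, of "f \<ominus>\<^bsub>F\<^esub> g" g] that
      by (simp add: a_minus_def F.M.a_assoc F.M.l_neg)
    then show ?thesis
      using that linear_mapD(1)[OF L] by (metis F.M.minus_closed W.M.add.r_cancel_one)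
  qed
  \<comment> \<open>The kernel of \<open>L\<close> is a submodule, so by minimality of
    \<open>tensor_kernel\<close> only the generating relations need to be examined.\<close>
  have sub: "submodule {f \<in> carrier F. L f = \<zero>\<^bsub>W\<^esub>} R F"
  proof (rule F.submoduleI)
    fix f assume f: "f \<in> {f \<in> carrier F. L f = \<zero>\<^bsub>W\<^esub>}"
    then have "\<ominus>\<^bsub>F\<^esub> f = (\<ominus> \<one>) \<odot>\<^bsub>F\<^esub> f"
      by (simp add: F.smult_l_minus)
    then show "\<ominus>\<^bsub>F\<^esub> f \<in> {f \<in> carrier F. L f = \<zero>\<^bsub>W\<^esub>}"
      using f by (simp add: linear_mapD(3)[OF L])
  qed (auto simp: L_zero linear_mapD[OF L])
  have "bilinear_relations R A B \<subseteq> {f \<in> carrier F. L f = \<zero>\<^bsub>W\<^esub>}"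
  proof
    fix r assume r: "r \<in> bilinear_relations R A B"
    then have "L r = \<zero>\<^bsub>W\<^esub>"
      unfolding bilinear_relations_def Let_def
      by (auto intro!: L_minus F.M.add.m_closed F.smult_closed gen_closed
        simp: linear_mapD[OF L] gen gen_closed \<beta>1 \<beta>2)
    with r show "r \<in> {f \<in> carrier F. L f = \<zero>\<^bsub>W\<^esub>}"
      using bilinear_relations_closed by blast
  qed
  then have "tensor_kernel R A B \<subseteq> {f \<in> carrier F. L f = \<zero>\<^bsub>W\<^esub>}"
    unfolding tensor_kernel_def by (rule submodule_generated_minimal[OF sub])
  then obtain \<phi> where "linear_map R T W \<phi>"
      "\<And>f. f \<in> carrier F \<Longrightarrow> \<phi> (tensor_kernel R A B +>\<^bsub>F\<^esub> f) = L f"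
    using Q.quotient_lift[OF W L] unfolding tensor_product_def by blast
  then show ?thesis
    using gen by (auto simp: pure_tensor_def gen_closed)
qed

text \<open>The universal property is applied twice, once for each tensor argument. Linearity in the
  arguments not yet lifted is recovered each time by comparing two linear maps on pure
  tensors.\<close>

lemma tensor_lift2:
  assumes W: "module R W"
    and \<gamma>1: "\<And>a b. \<lbrakk>a \<in> carrier A; b \<in> carrier B\<rbrakk> \<Longrightarrow> bilinear_map R A B W (\<gamma> a b)"
    and \<gamma>2: "\<And>a b. \<lbrakk>a \<in> carrier A; b \<in> carrier B\<rbrakk> \<Longrightarrow> bilinear_map R A B W (\<lambda>a' b'. \<gamma> a' b' a b)"
  shows "\<exists>m. bilinear_map R T T W m \<and>
    (\<forall>a\<in>carrier A. \<forall>b\<in>carrier B. \<forall>a'\<in>carrier A. \<forall>b'\<in>carrier B.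
      m (pt a b) (pt a' b') = \<gamma> a b a' b')"
proof -
  interpret W: module R W by (rule W)
  \<comment> \<open>First stage: \<open>p\<close> is the second pair of arguments of \<gamma> and
    stays fixed, while the first pair is lifted.\<close>
  have "\<forall>p\<in>carrier A \<times> carrier B. \<exists>\<phi>. linear_map R T W \<phi> \<and>
      (\<forall>a'\<in>carrier A. \<forall>b'\<in>carrier B. \<phi> (pt a' b') = \<gamma> a' b' (fst p) (snd p))"
    using tensor_lift[OF W \<gamma>2] by auto
  from bchoice[OF this] obtain \<Phi> where \<Phi>: "\<forall>p\<in>carrier A \<times> carrier B. linear_map R T W (\<Phi> p) \<and>
      (\<forall>a'\<in>carrier A. \<forall>b'\<in>carrier B. \<Phi> p (pt a' b') = \<gamma> a' b' (fst p) (snd p))" ..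
  define \<phi> where "\<phi> a b = \<Phi> (a, b)" for a b
  have \<phi>: "\<And>a b. \<lbrakk>a \<in> carrier A; b \<in> carrier B\<rbrakk> \<Longrightarrow> linear_map R T W (\<phi> a b)"
    and \<phi>_pt: "\<And>a b a' b'. \<lbrakk>a \<in> carrier A; b \<in> carrier B; a' \<in> carrier A; b' \<in> carrier B\<rbrakk> \<Longrightarrow>
      \<phi> a b (pt a' b') = \<gamma> a' b' a b"
    using \<Phi> by (simp_all add: \<phi>_def)
  note \<gamma>11 = linear_mapD[OF bilinear_mapD(1)[OF \<gamma>1]] and \<gamma>12 = linear_mapD[OF bilinear_mapD(2)[OF \<gamma>1]]
  \<comment> \<open>For each law both sides are linear in \<open>x\<close>, so it suffices to take
    \<open>x\<close> pure, where the law is the bilinearity of \<gamma> in its second pair.\<close>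
  have \<phi>_bilinear: "bilinear_map R A B W (\<lambda>a b. \<phi> a b x)" if x: "x \<in> carrier T" for x
  proof (intro bilinear_mapI linear_mapI)
    fix a b assume ab: "a \<in> carrier A" "b \<in> carrier B"
    show "\<phi> a b x \<in> carrier W" using linear_mapD(1)[OF \<phi>[OF ab] x] .
    then show "\<phi> a b x \<in> carrier W" .
    show "\<phi> (a \<oplus>\<^bsub>A\<^esub> a') b x = \<phi> a b x \<oplus>\<^bsub>W\<^esub> \<phi> a' b x" if "a' \<in> carrier A" for a'
      by (rule linear_map_eqI[OF \<phi> W.linear_map_add[OF \<phi> \<phi>]])
        (use that ab x in \<open>simp_all add: \<phi>_pt \<gamma>12\<close>)
    show "\<phi> a (b \<oplus>\<^bsub>B\<^esub> b') x = \<phi> a b x \<oplus>\<^bsub>W\<^esub> \<phi> a b' x" if "b' \<in> carrier B" for b'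
      by (rule linear_map_eqI[OF \<phi> W.linear_map_add[OF \<phi> \<phi>]])
        (use that ab x in \<open>simp_all add: \<phi>_pt \<gamma>11\<close>)
    show "\<phi> (c \<odot>\<^bsub>A\<^esub> a) b x = c \<odot>\<^bsub>W\<^esub> \<phi> a b x" if "c \<in> carrier R" for c
      by (rule linear_map_eqI[OF \<phi> W.linear_map_smult[OF \<phi>]])
        (use that ab x in \<open>simp_all add: \<phi>_pt \<gamma>12\<close>)
    show "\<phi> a (c \<odot>\<^bsub>B\<^esub> b) x = c \<odot>\<^bsub>W\<^esub> \<phi> a b x" if "c \<in> carrier R" for c
      by (rule linear_map_eqI[OF \<phi> W.linear_map_smult[OF \<phi>]])
        (use that ab x in \<open>simp_all add: \<phi>_pt \<gamma>11\<close>)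
  qed
  \<comment> \<open>Second stage: with the first tensor \<open>x\<close> fixed, the remaining pair
    is lifted. The result is linear in the second tensor by construction; linearity in
    \<open>x\<close> is inherited from \<phi>.\<close>
  have "\<forall>x\<in>carrier T. \<exists>\<psi>. linear_map R T W \<psi> \<and>
      (\<forall>a\<in>carrier A. \<forall>b\<in>carrier B. \<psi> (pt a b) = \<phi> a b x)"
    using tensor_lift[OF W \<phi>_bilinear] by blast
  from bchoice[OF this] obtain m where m: "\<And>x. x \<in> carrier T \<Longrightarrow> linear_map R T W (m x)"
    and m_pt: "\<And>x a b. \<lbrakk>x \<in> carrier T; a \<in> carrier A; b \<in> carrier B\<rbrakk> \<Longrightarrow> m x (pt a b) = \<phi> a b x"
    by blast
  have "bilinear_map R T T W m"
  proof (intro bilinear_mapI linear_mapI)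
    fix y assume y: "y \<in> carrier T"
    fix x assume x: "x \<in> carrier T"
    show "m x y \<in> carrier W" using linear_mapD(1)[OF m[OF x] y] .
    show "m (x \<oplus>\<^bsub>T\<^esub> x') y = m x y \<oplus>\<^bsub>W\<^esub> m x' y" if "x' \<in> carrier T" for x'
      by (rule linear_map_eqI[OF m W.linear_map_add[OF m m]])
        (use that x y in \<open>simp_all add: m_pt linear_mapD(2)[OF \<phi>]\<close>)
    show "m (c \<odot>\<^bsub>T\<^esub> x) y = c \<odot>\<^bsub>W\<^esub> m x y" if "c \<in> carrier R" for c
      by (rule linear_map_eqI[OF m W.linear_map_smult[OF m]])
        (use that x y in \<open>simp_all add: m_pt linear_mapD(3)[OF \<phi>]\<close>)
  qed (simp_all add: m linear_mapD[OF m])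
  then show ?thesis by (intro exI[of _ m]) (simp add: m_pt \<phi>_pt)
qed

end


section \<open>The product of a Zinbiel and a perm algebra\<close>

lemma (in bilinear_algebra) bilinear_mult: "bilinear_map R A A A (\<lambda>x y. x \<otimes>\<^bsub>A\<^esub> y)"
  by (intro bilinear_mapI linear_mapI)
    (simp_all add: mult_closed mult_add_left mult_add_right mult_smult_left mult_smult_right)

text \<open>The module axioms read only the carrier, zero, addition and scalar action, so a product
  may be placed in the field that \<open>tensor_product\<close> leaves undefined.\<close>

lemma module_mult_update: "module R M \<Longrightarrow> module R (M\<lparr>mult := m\<rparr>)"
  by (simp add: module_def module_axioms_def abelian_group_def abelian_monoid_def
    abelian_group_axioms_def)

lemma bilinear_algebra_mult_update:
  assumes "field R" and "module R M" and "bilinear_map R M M M m"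
  shows "bilinear_algebra R (M\<lparr>mult := m\<rparr>)"
  using assms
  by (intro bilinear_algebra.intro bilinear_algebra_axioms.intro module_mult_update)
    (simp_all add: bilinear_map_def linear_map_def)

locale zinbiel_perm = A: zinbiel_algebra R A + B: perm_algebra R B for R (structure) and A and B
begin

sublocale tensor R A B ..

abbreviation \<gamma> where
  "\<gamma> a1 b1 a2 b2 \<equiv>
    pt (a1 \<otimes>\<^bsub>A\<^esub> a2) (b1 \<otimes>\<^bsub>B\<^esub> b2) \<oplus>\<^bsub>T\<^esub> pt (a2 \<otimes>\<^bsub>A\<^esub> a1) (b2 \<otimes>\<^bsub>B\<^esub> b1)"

lemma tensor_mult_ex: "\<exists>m. is_tensor_mult R A B m"
proof -
  note A = bilinear_mapD[OF A.bilinear_mult] and B = bilinear_mapD[OF B.bilinear_mult]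
  \<comment> \<open>With the first pair fixed, the summands of \<gamma> are \<open>pt\<close>
    composed with left multiplications and \<open>pt\<close> composed with right multiplications.
    Fixing the second pair instead exchanges the two roles.\<close>
  have 1: "bilinear_map R A B T (\<gamma> a b)" if "a \<in> carrier A" "b \<in> carrier B" for a b
    using T.bilinear_map_add[OF bilinear_map_comp[OF bilinear_pt A(1)[OF that(1)] B(1)[OF that(2)]]
        bilinear_map_comp[OF bilinear_pt A(2)[OF that(1)] B(2)[OF that(2)]]] .
  have 2: "bilinear_map R A B T (\<lambda>a' b'. \<gamma> a' b' a b)"
    if "a \<in> carrier A" "b \<in> carrier B" for a b
    using T.bilinear_map_add[OF bilinear_map_comp[OF bilinear_pt A(2)[OF that(1)] B(2)[OF that(2)]]
        bilinear_map_comp[OF bilinear_pt A(1)[OF that(1)] B(1)[OF that(2)]]] .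
  obtain m where m: "bilinear_map R T T T m"
    and pt: "\<forall>a\<in>carrier A. \<forall>b\<in>carrier B. \<forall>a'\<in>carrier A. \<forall>b'\<in>carrier B.
      m (pt a b) (pt a' b') = \<gamma> a b a' b'"
    using tensor_lift2[OF T.module_axioms 1 2] by blast
  have "is_tensor_mult R A B m"
    unfolding is_tensor_mult_def
    using bilinear_algebra_mult_update[OF A.field_axioms T.module_axioms m] pt by blast
  then show ?thesis by (rule exI[where x = m])
qed

section \<open>Commutativity and associativity of any product that meets the specification\<close>

context
  fixes m
  assumes m: "is_tensor_mult R A B m"
begin

interpretation P: bilinear_algebra R "T\<lparr>mult := m\<rparr>"
  using m by (simp add: is_tensor_mult_def)

lemma tensor_mult_closed: "\<lbrakk>x \<in> carrier T; y \<in> carrier T\<rbrakk> \<Longrightarrow> m x y \<in> carrier T"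
  using P.mult_closed by simp

lemma tensor_mult_add:
  "\<lbrakk>x \<in> carrier T; y \<in> carrier T; z \<in> carrier T\<rbrakk> \<Longrightarrow> m (x \<oplus>\<^bsub>T\<^esub> y) z = m x z \<oplus>\<^bsub>T\<^esub> m y z"
  "\<lbrakk>x \<in> carrier T; y \<in> carrier T; z \<in> carrier T\<rbrakk> \<Longrightarrow> m x (y \<oplus>\<^bsub>T\<^esub> z) = m x y \<oplus>\<^bsub>T\<^esub> m x z"
  using P.mult_add_left P.mult_add_right by simp_all

lemma tensor_mult_smult:
  "\<lbrakk>c \<in> carrier R; x \<in> carrier T; y \<in> carrier T\<rbrakk> \<Longrightarrow> m (c \<odot>\<^bsub>T\<^esub> x) y = c \<odot>\<^bsub>T\<^esub> m x y"
  "\<lbrakk>c \<in> carrier R; x \<in> carrier T; y \<in> carrier T\<rbrakk> \<Longrightarrow> m x (c \<odot>\<^bsub>T\<^esub> y) = c \<odot>\<^bsub>T\<^esub> m x y"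
  using P.mult_smult_left P.mult_smult_right by simp_all

lemma tensor_mult_pt:
  "\<lbrakk>a1 \<in> carrier A; b1 \<in> carrier B; a2 \<in> carrier A; b2 \<in> carrier B\<rbrakk> \<Longrightarrow>
    m (pt a1 b1) (pt a2 b2) = \<gamma> a1 b1 a2 b2"
  using m by (simp add: is_tensor_mult_def)

lemmas tensor_mult_simps = tensor_mult_closed tensor_mult_add tensor_mult_smult

text \<open>Both sides are bilinear, which leaves two pure tensors; exchanging these swaps the
  summands of \<gamma>.\<close>

lemma tensor_mult_comm:
  assumes "x \<in> carrier T" and "y \<in> carrier T"
  shows "m x y = m y x"
  using assms
proof (induction arbitrary: y rule: tensor_induct)
  case (pure a b)
  from pure(3,1,2) show ?case
    by (induction rule: tensor_induct)
      (simp_all add: tensor_mult_simps tensor_mult_pt A.mult_closed B.mult_closed T.M.a_comm)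
qed (simp_all add: tensor_mult_simps)

lemma tensor_mult_assoc_pt:
  assumes A: "a1 \<in> carrier A" "a2 \<in> carrier A" "a3 \<in> carrier A"
    and B: "b1 \<in> carrier B" "b2 \<in> carrier B" "b3 \<in> carrier B"
  shows "m (m (pt a1 b1) (pt a2 b2)) (pt a3 b3) = m (pt a1 b1) (m (pt a2 b2) (pt a3 b3))"
proof -
  note closed = A B A.mult_closed B.mult_closed
  \<comment> \<open>These instances put the smaller index first in each left-bracketed triple
    product. Once \<open>A.zinbiel\<close> and \<open>B.perm_assoc\<close> have moved all brackets
    to the left and \<open>pt_add_left\<close> has split the sums, both sides consist of the same
    six pure tensors up to order.\<close>
  have "(b2 \<otimes>\<^bsub>B\<^esub> b1) \<otimes>\<^bsub>B\<^esub> b3 = (b1 \<otimes>\<^bsub>B\<^esub> b2) \<otimes>\<^bsub>B\<^esub> b3"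
    "(b3 \<otimes>\<^bsub>B\<^esub> b1) \<otimes>\<^bsub>B\<^esub> b2 = (b1 \<otimes>\<^bsub>B\<^esub> b3) \<otimes>\<^bsub>B\<^esub> b2"
    "(b3 \<otimes>\<^bsub>B\<^esub> b2) \<otimes>\<^bsub>B\<^esub> b1 = (b2 \<otimes>\<^bsub>B\<^esub> b3) \<otimes>\<^bsub>B\<^esub> b1"
    using B B.perm_left_commute by blast+
  then show ?thesis
    by (simp add: tensor_mult_simps tensor_mult_pt closed A.zinbiel B.perm_assoc pt_add_left T.M.a_ac)
qed

lemma tensor_mult_assoc:
  assumes "x \<in> carrier T" and "y \<in> carrier T" and "z \<in> carrier T"
  shows "m (m x y) z = m x (m y z)"
  using assms
proof (induction arbitrary: y z rule: tensor_induct)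
  case (pure a1 b1)
  note 1 = pure(1,2)
  from pure(3,4) show ?case
  proof (induction arbitrary: z rule: tensor_induct)
    case (pure a2 b2)
    from pure(3,1,2) 1 show ?case
      by (induction rule: tensor_induct) (simp_all add: tensor_mult_simps tensor_mult_assoc_pt)
  qed (use 1 in \<open>simp_all add: tensor_mult_simps\<close>)
qed (simp_all add: tensor_mult_simps)

lemma tensor_mult_comm_assoc: "comm_assoc_algebra R (T\<lparr>mult := m\<rparr>)"
  by (intro comm_assoc_algebra.intro comm_assoc_algebra_axioms.intro P.bilinear_algebra_axioms)
    (simp_all add: tensor_mult_assoc tensor_mult_comm)

end

text \<open>Two bilinear operations with the same values on pure tensors agree by induction in each
  argument. Agreement is claimed on the carrier only, since the specification says nothing about
  other sets.\<close>

lemma tensor_mult_unique: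
  assumes m: "is_tensor_mult R A B m" and m': "is_tensor_mult R A B m'"
    and "x \<in> carrier T" and "y \<in> carrier T"
  shows "m' x y = m x y"
  using assms(3,4)
proof (induction arbitrary: y rule: tensor_induct)
  case (pure a b)
  from pure(3,1,2) show ?case
    by (induction rule: tensor_induct)
      (simp_all add: tensor_mult_pt[OF m] tensor_mult_pt[OF m'] tensor_mult_simps[OF m]
        tensor_mult_simps[OF m'])
qed (simp_all add: tensor_mult_simps[OF m] tensor_mult_simps[OF m'])

end

theorem proposition2p10:
  fixes K :: "('k, 'm) ring_scheme"
    and A :: "('k, 'a, 'n) module_scheme"
    and B :: "('k, 'b, 'p) module_scheme"
  assumes "char_zero_field K"
    and "zinbiel_algebra K A"
    and "perm_algebra K B"
  shows "\<exists>m. is_tensor_mult K A B m \<and>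
           (\<forall>m'. is_tensor_mult K A B m' \<longrightarrow>
             (\<forall>x\<in>carrier (tensor_product K A B). \<forall>y\<in>carrier (tensor_product K A B).
               m' x y = m x y)) \<and>
           comm_assoc_algebra K (tensor_product K A B\<lparr>mult := m\<rparr>)"
proof -
  interpret K: char_zero_field K by (rule assms(1))
  interpret zinbiel_perm K A B using assms(2,3) by (simp add: zinbiel_perm_def)
  \<comment> \<open>Any witness will do, because uniqueness and the algebra laws were proved for
    every operation that meets the specification.\<close>
  obtain m where "is_tensor_mult K A B m"
    using tensor_mult_ex by blast
  then show ?thesis
    using tensor_mult_unique tensor_mult_comm_assoc by blast
qed

end
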